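(* Let $\Gamma$ be the zero-sum repeated game with symmetric information described in the context, and for $\lambda\in(0,1]$ let $v_\lambda:\Delta(K)\to\mathbb{R}$ be the value function of its $\lambda$-discounted game. Then $(v_\lambda)$ does not converge (pointwise on $\Delta(K)$) when $\lambda$ goes to $0$.
   Context: Zero-sum repeated game with symmetric information: there are a finite state space $K$, finite action sets $I$ (Player 1) and $J$ (Player 2), a finite set $A$ of public signals, a transition $q:K\times I\times J\to\Delta(K\times A)$ and a payoff function $g:K\times I\times J\to\mathbb{R}$, all known to both players. Given $p\in\Delta(K)$ (the set of probability measures on $K$), known to both players, the game $\Gamma^p$ is played as follows: an initial state $k_1$ is drawn from $p$ and is not announced. At each stage $m\ge1$ the players simultaneously and independently choose $i_m\in I$ and $j_m\in J$; the stage payoff is $g_m=g(k_m,i_m,j_m)$; a pair $(k_{m+1},a_m)$ is drawn from $q(k_m,i_m,j_m)$; both players observe $(i_m,j_m)$ and $a_m$ (but not the state $k_{m+1}$), and the game moves to state $k_{m+1}$. A behavior strategy maps each finite public history $(i_1,j_1,a_1,\dots,i_{m-1},j_{m-1},a_{m-1})$, $m\ge1$, to a probability distribution on the player's action set; $\Sigma$ and $\mathcal{T}$ denote the sets of behavior strategies of Players 1 and 2. For $\lambda\in(0,1]$, the $\lambda$-discounted game $\Gamma^p_\lambda$ has payoff $\gamma^p_\lambda(\sigma,\tau)=\mathbb{E}^p_{\sigma,\tau}\big(\sum_{m\ge1}\lambda(1-\lambda)^{m-1}g_m\big)$, maximized by Player 1 and minimized by Player 2, and $v_\lambda(p)=\max_{\sigma\in\Sigma}\min_{\tau\in\mathcal{T}}\gamma^p_\lambda(\sigma,\tau)=\min_{\tau\in\mathcal{T}}\max_{\sigma\in\Sigma}\gamma^p_\lambda(\sigma,\tau)$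 is its value. The particular game $\Gamma$: $K=\{1^*,1^{++},1^T,1^+,0^*,0^{++},0^+\}$, $I=J=\{C,Q\}$, $A=\{D,D'\}$. The payoff does not depend on actions: it is $1$ in states $1^*,1^{++},1^T,1^+$ and $0$ in states $0^*,0^{++},0^+$. States $1^*$ and $0^*$ are absorbing (the state never changes again; the signal there is irrelevant, say always $D$). In states $1^{++},1^T,1^+$ the transition depends only on Player 2's action; in states $0^{++},0^+$ it depends only on Player 1's action. According to the action of the controlling player, the transitions (next state, public signal) are: - state $1^{++}$: under $C$, $(1^T,D)$ with probability $1/2$ and $(1^{++},D')$ with probability $1/2$; under $Q$, $(1^*,D')$ with probability $1$; - state $1^T$: under $C$, $(1^{++},D)$ with probability $1/8$, $(1^+,D)$ with probability $3/8$, $(1^{++},D')$ with probability $1/2$; under $Q$, $(1^*,D')$ with probability $1$; - state $1^+$: under $C$, $(1^+,D)$ with probability $1/2$ and $(1^{++},D')$ with probability $1/2$; under $Q$, $(0^{++},D)$ with probability $1$; - state $0^{++}$: under $C$, $(0^{++},D)$ with probability $1/4$, $(0^+,D)$ with probability $1/4$, $(0^{++},D')$ with probability $1/2$; under $Q$, $(0^*,D')$ with probability $1$; - state $0^+$: under $C$, $(0^+,D)$ with probability $1/2$ and $(0^{++},D')$ with probability $1/2$; under $Q$, $(1^{++},D)$ with probability $1$. *)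

theory Defs
  imports "HOL-Probability.Probability"
begin

record ('k, 'i, 'j, 'a) game =
  trans :: "'k \<Rightarrow> 'i \<Rightarrow> 'j \<Rightarrow> ('k \<times> 'a) pmf"
  payoff :: "'k \<Rightarrow> 'i \<Rightarrow> 'j \<Rightarrow> real"

text \<open>Public histories are listed in chronological order.\<close>

type_synonym ('i, 'j, 'a, 'c) strategy = "('i \<times> 'j \<times> 'a) list \<Rightarrow> 'c pmf"

text \<open>
  The outcome \<open>(k, i, j, a, k')\<close> of stage \<open>m\<close> consists of the current state \<open>k\<close>, the actions
  \<open>i\<close>, \<open>j\<close>, the public signal \<open>a\<close> and the next state \<open>k'\<close>. Along a play, \<open>k'\<close> is repeated
  as the first component of the outcome of stage \<open>m + 1\<close>. Stages are numbered from \<open>0\<close>.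
\<close>

type_synonym ('k, 'i, 'j, 'a) outcome = "'k \<times> 'i \<times> 'j \<times> 'a \<times> 'k"

definition stage_pmf ::
  "('k, 'i, 'j, 'a) game \<Rightarrow> ('i, 'j, 'a, 'i) strategy \<Rightarrow> ('i, 'j, 'a, 'j) strategy \<Rightarrow>
    ('i \<times> 'j \<times> 'a) list \<Rightarrow> 'k \<Rightarrow> ('k, 'i, 'j, 'a) outcome pmf" where
  "stage_pmf G \<sigma> \<tau> h k =
    bind_pmf (\<sigma> h) (\<lambda>i. bind_pmf (\<tau> h) (\<lambda>j.
      map_pmf (\<lambda>(k', a). (k, i, j, a, k')) (trans G k i j)))"

definition history :: "nat \<Rightarrow> (nat \<Rightarrow> ('k, 'i, 'j, 'a) outcome) \<Rightarrow> ('i \<times> 'j \<times> 'a) list" where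
  "history m \<omega> = map (\<lambda>n. case \<omega> n of (k, i, j, a, k') \<Rightarrow> (i, j, a)) [0..<m]"

fun state_pmf :: "'k pmf \<Rightarrow> nat \<Rightarrow> (nat \<Rightarrow> ('k, 'i, 'j, 'a) outcome) \<Rightarrow> 'k pmf" where
  "state_pmf p 0 \<omega> = p"
| "state_pmf p (Suc m) \<omega> = (case \<omega> m of (k, i, j, a, k') \<Rightarrow> return_pmf k')"

definition outcome_kernel ::
  "('k, 'i, 'j, 'a) game \<Rightarrow> 'k pmf \<Rightarrow> ('i, 'j, 'a, 'i) strategy \<Rightarrow> ('i, 'j, 'a, 'j) strategy \<Rightarrow>
    nat \<Rightarrow> (nat \<Rightarrow> ('k, 'i, 'j, 'a) outcome) \<Rightarrow> ('k, 'i, 'j, 'a) outcome measure" where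
  "outcome_kernel G p \<sigma> \<tau> m \<omega> =
    measure_pmf (bind_pmf (state_pmf p m \<omega>) (stage_pmf G \<sigma> \<tau> (history m \<omega>)))"

interpretation play: Ionescu_Tulcea "outcome_kernel G p \<sigma> \<tau>" "\<lambda>_. count_space UNIV"
  for G :: "('k::finite, 'i::finite, 'j::finite, 'a::finite) game" and p \<sigma> \<tau>
proof (rule Ionescu_Tulcea.intro)
  fix m :: nat
  have "PiM {0..<m} (\<lambda>_. count_space (UNIV :: ('k, 'i, 'j, 'a) outcome set)) =
      count_space (PiE {0..<m} (\<lambda>_. UNIV))"
    by (rule count_space_PiM_finite) (simp_all add: countable_finite)
  then show "outcome_kernel G p \<sigma> \<tau> m
    \<in> measurable (PiM {0..<m} (\<lambda>_. count_space UNIV)) (subprob_algebra (count_space UNIV))"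
    by (auto simp: outcome_kernel_def space_subprob_algebra measure_pmf.subprob_space_axioms)
next
  fix m :: nat and \<omega> :: "nat \<Rightarrow> ('k, 'i, 'j, 'a) outcome"
  show "prob_space (outcome_kernel G p \<sigma> \<tau> m \<omega>)"
    by (simp add: outcome_kernel_def measure_pmf.prob_space_axioms)
qed

text \<open>
  The law on infinite plays induced by \<open>p\<close>, \<open>\<sigma>\<close>, \<open>\<tau>\<close>, obtained from the Ionescu-Tulcea theorem.
\<close>

definition play_measure ::
  "('k::finite, 'i::finite, 'j::finite, 'a::finite) game \<Rightarrow> 'k pmf \<Rightarrow>
    ('i, 'j, 'a, 'i) strategy \<Rightarrow> ('i, 'j, 'a, 'j) strategy \<Rightarrow>
    (nat \<Rightarrow> ('k, 'i, 'j, 'a) outcome) measure" where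
  "play_measure G p \<sigma> \<tau> = play.PF.lim G p \<sigma> \<tau>"

definition stage_payoff ::
  "('k, 'i, 'j, 'a) game \<Rightarrow> nat \<Rightarrow> (nat \<Rightarrow> ('k, 'i, 'j, 'a) outcome) \<Rightarrow> real" where
  "stage_payoff G m \<omega> = (case \<omega> m of (k, i, j, a, k') \<Rightarrow> payoff G k i j)"

text \<open>The stage usually numbered \<open>m \<ge> 1\<close> has index \<open>m - 1\<close> here, whence the exponent \<open>m\<close>.\<close>

definition disc_payoff ::
  "('k::finite, 'i::finite, 'j::finite, 'a::finite) game \<Rightarrow> real \<Rightarrow> 'k pmf \<Rightarrow>
    ('i, 'j, 'a, 'i) strategy \<Rightarrow> ('i, 'j, 'a, 'j) strategy \<Rightarrow> real" where
  "disc_payoff G l p \<sigma> \<tau> =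
    (\<integral>\<omega>. (\<Sum>m. l * (1 - l) ^ m * stage_payoff G m \<omega>) \<partial>play_measure G p \<sigma> \<tau>)"

text \<open>
  For \<open>0 < l \<le> 1\<close> the payoff is bounded, so the supremum and infimum are genuine. They are attained
  and equal to the min-max, so this is the value \<open>v\<^sub>l(p)\<close> of the \<open>l\<close>-discounted game.
\<close>

definition disc_value ::
  "('k::finite, 'i::finite, 'j::finite, 'a::finite) game \<Rightarrow> real \<Rightarrow> 'k pmf \<Rightarrow> real" where
  "disc_value G l p = (SUP \<sigma>. INF \<tau>. disc_payoff G l p \<sigma> \<tau>)"


text \<open>
  \<open>One\<close> and \<open>Zero\<close> are the stage payoffs; \<open>PP\<close>, \<open>P\<close>, \<open>T\<close>, \<open>Star\<close> stand for the superscripts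
  \<open>++\<close>, \<open>+\<close>, \<open>T\<close>, \<open>*\<close>.
\<close>

datatype state = OneStar | OnePP | OneT | OneP | ZeroStar | ZeroPP | ZeroP
datatype action = C | Q
datatype signal = D | D'

lemma UNIV_state: "UNIV = {OneStar, OnePP, OneT, OneP, ZeroStar, ZeroPP, ZeroP}"
  by (auto intro: state.exhaust)

lemma UNIV_action: "UNIV = {C, Q}"
  by (auto intro: action.exhaust)

lemma UNIV_signal: "UNIV = {D, D'}"
  by (auto intro: signal.exhaust)

instance state :: finite
  by standard (simp add: UNIV_state)

instance action :: finite
  by standard (simp add: UNIV_action)

instance signal :: finite
  by standard (simp add: UNIV_signal)

text \<open>The action is that of the player controlling the state (see \<open>\<Gamma>\<close> below).\<close>

fun controlled_law :: "state \<Rightarrow> action \<Rightarrow> ((state \<times> signal) \<times> real) list" where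
  "controlled_law OneStar _ = [((OneStar, D), 1)]"
| "controlled_law ZeroStar _ = [((ZeroStar, D), 1)]"
| "controlled_law OnePP C = [((OneT, D), 1/2), ((OnePP, D'), 1/2)]"
| "controlled_law OnePP Q = [((OneStar, D'), 1)]"
| "controlled_law OneT C = [((OnePP, D), 1/8), ((OneP, D), 3/8), ((OnePP, D'), 1/2)]"
| "controlled_law OneT Q = [((OneStar, D'), 1)]"
| "controlled_law OneP C = [((OneP, D), 1/2), ((OnePP, D'), 1/2)]"
| "controlled_law OneP Q = [((ZeroPP, D), 1)]"
| "controlled_law ZeroPP C = [((ZeroPP, D), 1/4), ((ZeroP, D), 1/4), ((ZeroPP, D'), 1/2)]"
| "controlled_law ZeroPP Q = [((ZeroStar, D'), 1)]"
| "controlled_law ZeroP C = [((ZeroP, D), 1/2), ((ZeroPP, D'), 1/2)]"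
| "controlled_law ZeroP Q = [((OnePP, D), 1)]"

lemma controlled_law_wf: "pmf_of_list_wf (controlled_law k c)"
  by (cases k; cases c) (auto simp: pmf_of_list_wf_def)

definition \<Gamma> :: "(state, action, action, signal) game" where
  "\<Gamma> = \<lparr> trans = (\<lambda>k i j. pmf_of_list
           (controlled_law k (if k \<in> {OnePP, OneT, OneP} then j else i))),
         payoff = (\<lambda>k i j. if k \<in> {OneStar, OnePP, OneT, OneP} then 1 else 0) \<rparr>"

end

theory Submission
  imports Defs "HOL-Real_Asymp.Real_Asymp"
begin

text \<open>
  The state controlled by a player has the bad payoff for that player, who wants to quit to the
  other side. Quitting too early is dangerous: in the state \<open>++\<close> (or \<open>T\<close>) it leads to absorption with the
  bad payoff forever. By waiting, that is, by playing \<open>C\<close> until enough consecutive signals \<open>D\<close> have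
  arrived, the player makes the dangerous state unlikely. But each \<open>D'\<close> starts the wait again, so
  that \<open>m\<close> consecutive signals take about \<open>2 ^ (m + 1)\<close> stages, at a discounted cost of
  about \<open>2 * l * 2 ^ m\<close>. For Player 1 the risk that remains is \<open>1 / 2 ^ m\<close>, for Player 2 it is
  \<open>1 / 4 ^ (m div 2)\<close>. The two agree for even \<open>m\<close>, but an odd number of signals is useless to Player 2.

  Cost plus risk is of the form \<open>s * (u + 1 / u)\<close> with \<open>s = sqrt (2 * l)\<close> and \<open>u = s * 2 ^ m\<close>. Take
  \<open>s = (1/2) ^ N\<close>. Player 1 achieves the minimum \<open>2 * s\<close> by \<open>m = N\<close>. So does Player 2 if \<open>N\<close> is
  even; but if \<open>N\<close> is odd, \<open>u\<close> is restricted to odd powers of two and Player 2 has to lose at least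
  \<open>5/2 * s\<close>. When both players quit and the losses per visit to their sides are \<open>\<alpha> * s\<close> for
  Player 2 and \<open>\<beta> * s\<close> for Player 1, the discounted share of the stages with payoff 1 is
  close to \<open>\<alpha> / (\<alpha> + \<beta>)\<close>. Hence the value from \<open>OnePP\<close> is at most about \<open>1/2\<close> for even \<open>N\<close>
  (\<open>disc_value_le_even\<close>) and at least about \<open>5/9\<close> for odd \<open>N\<close> (\<open>disc_value_ge_odd\<close>), so it
  has no limit.

  Both bounds come from one explicit strategy of one player against arbitrary behavior strategies
  of the other, so no minimax theorem is involved. The guarantee of a strategy is verified by a
  potential \<open>V\<close> on public beliefs that the Shapley operator does not increase or does not decrease
  (\<open>disc_payoff_le_superharmonic\<close>, \<open>disc_payoff_ge_subharmonic\<close>). The passage from the measure on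
  infinite plays to the finite-horizon recursion in which this induction takes place is
  \<open>disc_payoff_horizon_limit\<close>.
\<close>

section \<open>Finite horizons\<close>

lemma PiM_outcomes:
  "PiM {0..<n::nat} (\<lambda>_. count_space (UNIV :: 'z::finite set)) = count_space (PiE {0..<n} (\<lambda>_. UNIV))"
  by (rule count_space_PiM_finite) (auto simp: countable_finite)

lemma finite_outcomes: "finite (PiE {0..<n::nat} (\<lambda>_. UNIV :: 'z::finite set))"
  by (intro finite_PiE) auto

text \<open>
  The outcome spaces are finite, so every function of a finite prefix of the play is measurable and
  bounded. Hence one step of the Ionescu-Tulcea construction can be integrated out with no
  condition on the integrand.
\<close>

lemma integral_C_Suc:
  fixes G :: "('k::finite, 'i::finite, 'j::finite, 'a::finite) game"
    and F :: "(nat \<Rightarrow> ('k, 'i, 'j, 'a) outcome) \<Rightarrow> real"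
  shows "(\<integral>\<omega>. F \<omega> \<partial>play.C G p \<sigma> \<tau> 0 (Suc n) (\<lambda>_. undefined)) =
    (\<integral>\<omega>. (\<integral>y. F (fun_upd \<omega> n y) \<partial>outcome_kernel G p \<sigma> \<tau> n \<omega>) \<partial>play.C G p \<sigma> \<tau> 0 n (\<lambda>_. undefined))"
proof -
  let ?C = "play.C G p \<sigma> \<tau> 0 n (\<lambda>_. undefined)"
  let ?S = "\<lambda>n. PiE {0..<n} (\<lambda>_. UNIV) :: (nat \<Rightarrow> ('k, 'i, 'j, 'a) outcome) set"
  define B where "B = Max ((\<lambda>\<omega>. \<bar>F \<omega>\<bar>) ` ?S (Suc n))"
  have B: "\<bar>F \<omega>\<bar> \<le> B" if "\<omega> \<in> ?S (Suc n)" for \<omega>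
    unfolding B_def using that finite_outcomes by (intro Max_ge) auto
  have sC: "space ?C = ?S n"
    using play.space_C[of "\<lambda>_. undefined" 0 G p \<sigma> \<tau> n] by (simp add: space_PiM)
  have sets_C: "sets ?C = sets (count_space (?S n))"
    using play.sets_C[of "\<lambda>_. undefined" 0 G p \<sigma> \<tau> n] by (simp add: PiM_outcomes)
  interpret C: prob_space ?C by (rule play.prob_space_C) simp
  have "(\<integral>\<omega>. F \<omega> \<partial>play.C G p \<sigma> \<tau> 0 (Suc n) (\<lambda>_. undefined)) =
      (\<integral>\<omega>. (\<integral>x. F x \<partial>play.eP G p \<sigma> \<tau> n \<omega>) \<partial>?C)"
    unfolding play.C.simps add_0
  proof (rule integral_bind[where K="count_space (?S (Suc n))" and B=B and B'=1])
    show "play.eP G p \<sigma> \<tau> n \<in> ?C \<rightarrow>\<^sub>M subprob_algebra (count_space (?S (Suc n)))"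
      using play.measurable_eP[of G p \<sigma> \<tau> n]
      unfolding PiM_outcomes measurable_cong_sets[OF sets_C refl] .
    show "AE \<omega> in ?C. emeasure (play.eP G p \<sigma> \<tau> n \<omega>) (space (play.eP G p \<sigma> \<tau> n \<omega>)) \<le> ennreal 1"
      using play.prob_space_eP[of _ n G p \<sigma> \<tau>, THEN prob_space.emeasure_space_1]
      by (intro AE_I2) (simp add: sC space_PiM)
  qed (auto simp: B C.finite_measure_axioms)
  also have "\<dots> = (\<integral>\<omega>. (\<integral>y. F (fun_upd \<omega> n y) \<partial>outcome_kernel G p \<sigma> \<tau> n \<omega>) \<partial>?C)"
  proof (intro Bochner_Integration.integral_cong refl)
    fix \<omega> assume "\<omega> \<in> space ?C"
    then have \<omega>: "\<omega> \<in> ?S n" by (simp add: sC)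
    have "fun_upd \<omega> n \<in> outcome_kernel G p \<sigma> \<tau> n \<omega> \<rightarrow>\<^sub>M count_space (?S (Suc n))"
      using \<omega> by (auto simp: outcome_kernel_def PiE_iff extensional_def)
    then show "(\<integral>x. F x \<partial>play.eP G p \<sigma> \<tau> n \<omega>) = (\<integral>y. F (fun_upd \<omega> n y) \<partial>outcome_kernel G p \<sigma> \<tau> n \<omega>)"
      unfolding play.eP_def PiM_outcomes by (rule integral_distr) simp
  qed
  finally show ?thesis .
qed
lemma integral_play_measure_restrict:
  fixes G :: "('k::finite, 'i::finite, 'j::finite, 'a::finite) game"
    and F :: "(nat \<Rightarrow> ('k, 'i, 'j, 'a) outcome) \<Rightarrow> real"
  shows "(\<integral>\<omega>. F (restrict \<omega> {0..<n}) \<partial>play_measure G p \<sigma> \<tau>) =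
    (\<integral>\<omega>. F \<omega> \<partial>play.C G p \<sigma> \<tau> 0 n (\<lambda>_. undefined))"
proof -
  let ?M = "\<lambda>n. PiM {0..<n::nat} (\<lambda>_. count_space (UNIV :: ('k, 'i, 'j, 'a) outcome set))"
  have F: "F \<in> borel_measurable (?M n)"
    by (simp add: PiM_outcomes)
  have up: "play.up_to {0..<n} = n"
    using play.up_to_iff[of "{0..<n}" n] play.up_to_iff[of "{0..<n}" "play.up_to {0..<n}"]
    by (intro antisym) (auto simp: not_less[symmetric])
  have "(\<integral>\<omega>. F (restrict \<omega> {0..<n}) \<partial>play_measure G p \<sigma> \<tau>) =
      (\<integral>\<omega>. F \<omega> \<partial>distr (play_measure G p \<sigma> \<tau>) (?M n) (\<lambda>\<omega>. restrict \<omega> {0..<n}))"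
    by (rule integral_distr[symmetric, OF _ F])
       (simp add: play_measure_def measurable_restrict_subset cong: measurable_cong_sets)
  also have "\<dots> = (\<integral>\<omega>. F \<omega> \<partial>play.CI G p \<sigma> \<tau> {0..<n})"
    unfolding play_measure_def by (simp add: play.distr_lim)
  also have "\<dots> = (\<integral>\<omega>. F \<omega> \<partial>play.C G p \<sigma> \<tau> 0 n (\<lambda>_. undefined))"
    unfolding play.CI_def up using play.distr_C[of n n "\<lambda>_. undefined" 0 G p \<sigma> \<tau>] by simp
  finally show ?thesis .
qed

text \<open>
  The discounted payoff of the first \<open>n\<close> stages after the history \<open>h\<close> when the current state is
  \<open>k\<close>, by backward recursion. The continuation starts from a known state; uncertainty about
  \<open>k\<close> enters only when these numbers are averaged against a belief, which is a linear operation.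
\<close>

primrec horizon_payoff ::
  "('k, 'i, 'j, 'a) game \<Rightarrow> real \<Rightarrow> ('i, 'j, 'a, 'i) strategy \<Rightarrow> ('i, 'j, 'a, 'j) strategy \<Rightarrow>
    nat \<Rightarrow> ('i \<times> 'j \<times> 'a) list \<Rightarrow> 'k \<Rightarrow> real" where
  "horizon_payoff G l \<sigma> \<tau> 0 h k = 0"
| "horizon_payoff G l \<sigma> \<tau> (Suc n) h k =
    (\<integral>y. (case y of (k, i, j, a, k') \<Rightarrow>
       l * payoff G k i j + (1 - l) * horizon_payoff G l \<sigma> \<tau> n (h @ [(i, j, a)]) k')
     \<partial>stage_pmf G \<sigma> \<tau> h k)"

definition truncated_payoff ::
  "('k, 'i, 'j, 'a) game \<Rightarrow> real \<Rightarrow> nat \<Rightarrow> (nat \<Rightarrow> ('k, 'i, 'j, 'a) outcome) \<Rightarrow> real" where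
  "truncated_payoff G l n \<omega> = (\<Sum>m<n. l * (1 - l) ^ m * stage_payoff G m \<omega>)"

lemma integral_finite_pmf_add_mult:
  fixes p :: "'z::finite pmf" and a b :: real
  shows "(\<integral>x. a + b * f x \<partial>p) = a + b * (\<integral>x. f x \<partial>p)"
  by (subst Bochner_Integration.integral_add)
     (auto simp: integrable_measure_pmf_finite)

lemma integral_bind_finite_pmf:
  fixes p :: "'z::finite pmf" and q :: "'z \<Rightarrow> 'y::finite pmf" and f :: "'y \<Rightarrow> real"
  shows "(\<integral>y. f y \<partial>bind_pmf p q) = (\<integral>x. (\<integral>y. f y \<partial>q x) \<partial>p)"
  using pmf_expectation_bind[of UNIV q p f]
  by (simp add: integral_measure_pmf[of UNIV])

lemma integral_outcome_kernel:
  fixes G :: "('k::finite, 'i::finite, 'j::finite, 'a::finite) game"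
    and f :: "('k, 'i, 'j, 'a) outcome \<Rightarrow> real"
  shows "(\<integral>y. f y \<partial>outcome_kernel G p \<sigma> \<tau> n \<omega>) =
    (\<integral>k. (\<integral>y. f y \<partial>stage_pmf G \<sigma> \<tau> (history n \<omega>) k) \<partial>state_pmf p n \<omega>)"
  unfolding outcome_kernel_def by (rule integral_bind_finite_pmf)

lemma history_Suc_upd:
  "history (Suc n) (fun_upd \<omega> n y) = history n \<omega> @ [case y of (k, i, j, a, k') \<Rightarrow> (i, j, a)]"
  by (simp add: history_def)

lemma truncated_payoff_Suc_upd:
  "truncated_payoff G l (Suc n) (fun_upd \<omega> n y) =
    truncated_payoff G l n \<omega> + l * (1 - l) ^ n * (case y of (k, i, j, a, k') \<Rightarrow> payoff G k i j)"
  by (simp add: truncated_payoff_def stage_payoff_def)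

text \<open>
  This reconciles the forward construction of the play measure with the backward recursion of
  \<open>horizon_payoff\<close>: stopping after \<open>n\<close> stages and adding the expected payoff of the next \<open>m\<close>
  stages gives a number that depends on \<open>n + m\<close> only. Increasing \<open>n\<close> by one integrates out one
  kernel, which turns the continuation with \<open>m\<close> stages into the one with \<open>m + 1\<close> stages.
\<close>

lemma integral_C_truncated_payoff:
  fixes G :: "('k::finite, 'i::finite, 'j::finite, 'a::finite) game"
  shows "(\<integral>\<omega>. truncated_payoff G l n \<omega> +
        (1 - l) ^ n * (\<integral>k. horizon_payoff G l \<sigma> \<tau> m (history n \<omega>) k \<partial>state_pmf p n \<omega>)
      \<partial>play.C G p \<sigma> \<tau> 0 n (\<lambda>_. undefined)) =
    (\<integral>k. horizon_payoff G l \<sigma> \<tau> (n + m) [] k \<partial>p)"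
proof (induction n arbitrary: m)
  case 0
  let ?M = "PiM {0..<0::nat} (\<lambda>_. count_space (UNIV :: ('k, 'i, 'j, 'a) outcome set))"
  have "(\<lambda>_. undefined) \<in> space ?M" by simp
  then have "measure (return ?M (\<lambda>_. undefined)) (space ?M) = 1"
    using prob_space.prob_space[OF prob_space_return] by (metis space_return)
  then show ?case
    by (simp add: truncated_payoff_def history_def)
next
  case (Suc n)
  let ?J = "horizon_payoff G l \<sigma> \<tau>"
  define R where "R \<omega> = truncated_payoff G l (Suc n) \<omega> +
    (1 - l) ^ Suc n * (\<integral>k. ?J m (history (Suc n) \<omega>) k \<partial>state_pmf p (Suc n) \<omega>)" for \<omega>
  have upd: "R (fun_upd \<omega> n y) = truncated_payoff G l n \<omega> + (1 - l) ^ n *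
      (case y of (k, i, j, a, k') \<Rightarrow>
        l * payoff G k i j + (1 - l) * ?J m (history n \<omega> @ [(i, j, a)]) k')" for \<omega> y
    by (cases y) (simp add: R_def history_Suc_upd truncated_payoff_Suc_upd algebra_simps)
  have "(\<integral>y. R (fun_upd \<omega> n y) \<partial>outcome_kernel G p \<sigma> \<tau> n \<omega>) =
      truncated_payoff G l n \<omega> +
        (1 - l) ^ n * (\<integral>k. ?J (Suc m) (history n \<omega>) k \<partial>state_pmf p n \<omega>)" for \<omega>
    unfolding upd integral_outcome_kernel integral_finite_pmf_add_mult
    by simp
  then have "(\<integral>\<omega>. R \<omega> \<partial>play.C G p \<sigma> \<tau> 0 (Suc n) (\<lambda>_. undefined)) =
      (\<integral>k. ?J (n + Suc m) [] k \<partial>p)"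
    unfolding integral_C_Suc using Suc.IH[of "Suc m"] by simp
  then show ?case by (simp add: R_def)
qed

lemma integral_truncated_payoff:
  fixes G :: "('k::finite, 'i::finite, 'j::finite, 'a::finite) game"
  shows "(\<integral>\<omega>. truncated_payoff G l n \<omega> \<partial>play_measure G p \<sigma> \<tau>) =
    (\<integral>k. horizon_payoff G l \<sigma> \<tau> n [] k \<partial>p)"
proof -
  have "truncated_payoff G l n \<omega> = truncated_payoff G l n (restrict \<omega> {0..<n})" for \<omega>
    by (simp add: truncated_payoff_def stage_payoff_def)
  then have "(\<integral>\<omega>. truncated_payoff G l n \<omega> \<partial>play_measure G p \<sigma> \<tau>) =
      (\<integral>\<omega>. truncated_payoff G l n \<omega> \<partial>play.C G p \<sigma> \<tau> 0 n (\<lambda>_. undefined))"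
    using integral_play_measure_restrict[where F = "truncated_payoff G l n" and n = n] by simp
  then show ?thesis
    using integral_C_truncated_payoff[where m = 0] by simp
qed

lemma payoff_bounded:
  fixes G :: "('k::finite, 'i::finite, 'j::finite, 'a::finite) game"
  obtains B where "\<And>k i j. \<bar>payoff G k i j\<bar> \<le> B"
proof
  show "\<bar>payoff G k i j\<bar> \<le> Max (range (\<lambda>(k, i, j). \<bar>payoff G k i j\<bar>))" for k i j
    by (intro Max_ge) (auto intro!: image_eqI[of _ _ "(k, i, j)"])
qed

text \<open>
  The truncations are dominated by a bound for the stage payoff, so finite horizons determine the
  discounted payoff and the infinite play measure can be forgotten from here on.
\<close>

lemma disc_payoff_horizon_limit:
  fixes G :: "('k::finite, 'i::finite, 'j::finite, 'a::finite) game"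
  assumes l: "0 < l" "l \<le> 1"
  shows "(\<lambda>n. \<integral>k. horizon_payoff G l \<sigma> \<tau> n [] k \<partial>measure_pmf p) \<longlonglongrightarrow> disc_payoff G l p \<sigma> \<tau>"
proof -
  let ?P = "play_measure G p \<sigma> \<tau>"
  obtain B where "\<And>k i j. \<bar>payoff G k i j\<bar> \<le> B"
    using payoff_bounded[of G] by blast
  then have B: "\<bar>stage_payoff G m \<omega>\<bar> \<le> B" for m \<omega>
    by (auto simp: stage_payoff_def split: prod.split)
  have geo: "(\<lambda>m. l * (1 - l) ^ m * B) sums B"
    using sums_mult[OF geometric_sums[of "1 - l"], of "l * B"] l by (simp add: mult_ac)
  have bnd: "norm (l * (1 - l) ^ m * stage_payoff G m \<omega>) \<le> l * (1 - l) ^ m * B" for m \<omega>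
    using B[of m \<omega>] l by (auto simp: abs_mult intro!: mult_left_mono)
  have summ: "summable (\<lambda>m. l * (1 - l) ^ m * stage_payoff G m \<omega>)" for \<omega>
    using geo by (intro summable_comparison_test'[OF sums_summable bnd]) 
  have prob: "prob_space ?P"
  proof (rule prob_space_distrD)
    show "(\<lambda>\<omega>. restrict \<omega> {}) \<in> ?P \<rightarrow>\<^sub>M PiM {} (\<lambda>_. count_space UNIV)"
      by (simp add: play_measure_def measurable_restrict_subset cong: measurable_cong_sets)
    show "prob_space (distr ?P (PiM {} (\<lambda>_. count_space UNIV)) (\<lambda>\<omega>. restrict \<omega> {}))"
      unfolding play_measure_def play.distr_lim[OF finite.emptyI]
      by (rule play.PF.prob_space_P) simp_all
  qed
  then interpret prob_space ?P .
  have meas: "(\<lambda>\<omega>. stage_payoff G m \<omega>) \<in> borel_measurable ?P" for m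
    unfolding play_measure_def stage_payoff_def
    by (rule measurable_compose[of "\<lambda>\<omega>. \<omega> m" _ "count_space UNIV"]) 
       (simp_all add: measurable_cong_sets[OF play.PF.sets_lim refl] measurable_component_singleton)
  have "(\<lambda>n. \<integral>\<omega>. truncated_payoff G l n \<omega> \<partial>?P) \<longlonglongrightarrow> disc_payoff G l p \<sigma> \<tau>"
    unfolding disc_payoff_def
  proof (rule integral_dominated_convergence[where w = "\<lambda>_. B"])
    show "AE \<omega> in ?P. (\<lambda>n. truncated_payoff G l n \<omega>) \<longlonglongrightarrow>
        (\<Sum>m. l * (1 - l) ^ m * stage_payoff G m \<omega>)"
      unfolding truncated_payoff_def using summ by (intro AE_I2 summable_LIMSEQ)
    show "AE \<omega> in ?P. norm (truncated_payoff G l n \<omega>) \<le> B" for n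
    proof (rule AE_I2)
      fix \<omega>
      have "norm (truncated_payoff G l n \<omega>) \<le> (\<Sum>m<n. l * (1 - l) ^ m * B)"
        unfolding truncated_payoff_def by (rule sum_norm_le) (rule bnd)
      also have "\<dots> \<le> B"
        using sum_le_suminf[OF sums_summable[OF geo], of "{..<n}"] sums_unique[OF geo]
          order_trans[OF norm_ge_zero bnd] by auto
      finally show "norm (truncated_payoff G l n \<omega>) \<le> B" .
    qed
  qed (use meas in \<open>auto simp: truncated_payoff_def\<close>)
  then show ?thesis by (simp add: integral_truncated_payoff)
qed

lemma horizon_payoff_bounded:
  fixes G :: "('k::finite, 'i::finite, 'j::finite, 'a::finite) game"
  assumes l: "0 < l" "l \<le> 1" and B: "\<And>k i j. \<bar>payoff G k i j\<bar> \<le> B"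
  shows "\<bar>horizon_payoff G l \<sigma> \<tau> n h k\<bar> \<le> B"
proof (induction n arbitrary: h k)
  case 0
  show ?case using order_trans[OF abs_ge_zero B] by simp
next
  case (Suc n)
  let ?f = "\<lambda>(k, i, j, a, k').
    l * payoff G k i j + (1 - l) * horizon_payoff G l \<sigma> \<tau> n (h @ [(i, j, a)]) k'"
  have f: "\<bar>?f y\<bar> \<le> B" for y
  proof (cases y)
    case (fields k i j a k')
    have "\<bar>?f y\<bar> \<le> l * \<bar>payoff G k i j\<bar> + (1 - l) * \<bar>horizon_payoff G l \<sigma> \<tau> n (h @ [(i, j, a)]) k'\<bar>"
      using l by (auto simp: fields abs_mult intro: order_trans[OF abs_triangle_ineq])
    also have "\<dots> \<le> l * B + (1 - l) * B"
      using l B Suc by (intro add_mono mult_left_mono) auto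
    finally show ?thesis by (simp add: algebra_simps)
  qed
  have int: "integrable (stage_pmf G \<sigma> \<tau> h k) ?f"
    by (intro integrable_measure_pmf_finite) simp
  have "(\<integral>y. ?f y \<partial>stage_pmf G \<sigma> \<tau> h k) \<le> B"
    using f by (intro measure_pmf.integral_le_const[OF int] AE_I2) (auto simp: abs_le_iff)
  moreover have "(\<integral>y. ?f y \<partial>stage_pmf G \<sigma> \<tau> h k) \<ge> - B"
    using f by (intro measure_pmf.integral_ge_const[OF int] AE_I2) (auto simp: abs_le_iff minus_le_iff)
  ultimately show ?case by (simp add: abs_le_iff)
qed

lemma disc_payoff_bounded:
  fixes G :: "('k::finite, 'i::finite, 'j::finite, 'a::finite) game"
  assumes l: "0 < l" "l \<le> 1" and B: "\<And>k i j. \<bar>payoff G k i j\<bar> \<le> B"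
  shows "\<bar>disc_payoff G l p \<sigma> \<tau>\<bar> \<le> B"
proof -
  have "\<bar>\<integral>k. horizon_payoff G l \<sigma> \<tau> n [] k \<partial>measure_pmf p\<bar> \<le> B" for n
    using horizon_payoff_bounded[OF l B, of \<sigma> \<tau> n "[]"]
    by (auto simp: abs_le_iff minus_le_iff intro!: measure_pmf.integral_le_const
          measure_pmf.integral_ge_const integrable_measure_pmf_finite AE_I2)
  then show ?thesis
    by (intro LIMSEQ_le_const2[OF tendsto_rabs[OF disc_payoff_horizon_limit[OF l]]]) auto
qed

text \<open>
  The value is a supremum of infima of real numbers, so it can be compared with the guarantee of
  one strategy only after the payoffs are known to be bounded.
\<close>

lemma disc_value_le:
  fixes G :: "('k::finite, 'i::finite, 'j::finite, 'a::finite) game"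
  assumes l: "0 < l" "l \<le> 1" and c: "\<And>\<sigma>. disc_payoff G l p \<sigma> \<tau> \<le> c"
  shows "disc_value G l p \<le> c"
proof -
  obtain B where B: "\<And>k i j. \<bar>payoff G k i j\<bar> \<le> B"
    using payoff_bounded[of G] by blast
  have "bdd_below (range (disc_payoff G l p \<sigma>))" for \<sigma>
    using disc_payoff_bounded[OF l B] by (intro bdd_belowI2[of _ "- B"]) (simp add: abs_le_iff minus_le_iff)
  then show ?thesis
    unfolding disc_value_def by (intro cSUP_least cINF_lower2[where x = \<tau>] c) auto
qed

lemma disc_value_ge:
  fixes G :: "('k::finite, 'i::finite, 'j::finite, 'a::finite) game"
  assumes l: "0 < l" "l \<le> 1" and c: "\<And>\<tau>. c \<le> disc_payoff G l p \<sigma> \<tau>"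
  shows "c \<le> disc_value G l p"
proof -
  obtain B where B: "\<And>k i j. \<bar>payoff G k i j\<bar> \<le> B"
    using payoff_bounded[of G] by blast
  have bb: "bdd_below (range (disc_payoff G l p \<sigma>))" for \<sigma>
    using disc_payoff_bounded[OF l B] by (intro bdd_belowI2[of _ "- B"]) (simp add: abs_le_iff minus_le_iff)
  have "(INF \<tau>. disc_payoff G l p \<sigma> \<tau>) \<le> B" for \<sigma>
    using disc_payoff_bounded[OF l B] by (intro cINF_lower2[OF bb UNIV_I]) (auto simp: abs_le_iff)
  then have "bdd_above (range (\<lambda>\<sigma>. INF \<tau>. disc_payoff G l p \<sigma> \<tau>))"
    by (intro bdd_aboveI2)
  then show ?thesis
    unfolding disc_value_def by (intro cSUP_upper2[where x = \<sigma>] cINF_greatest) (auto intro: c)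
qed

section \<open>Verification by potentials on public beliefs\<close>

text \<open>
  A public state \<open>s\<close> labels a common belief \<open>belief s\<close> about the hidden state, and \<open>bayes\<close> says
  that Bayes' rule sends labels to labels: after the actions \<open>i\<close>, \<open>j\<close> the signal \<open>a\<close> has
  probability \<open>signal_prob s i j a\<close>, and the posterior is the belief labelled by
  \<open>upd s i j a\<close>. Using labels instead of points of the simplex allows the reachable
  beliefs to be listed explicitly. The equation is multiplied out, so it does not constrain
  the label that follows a signal of probability zero.
\<close>

locale public_belief =
  fixes G :: "('k::finite, 'i::finite, 'j::finite, 'a::finite) game"
    and belief :: "'s \<Rightarrow> 'k \<Rightarrow> real"
    and upd :: "'s \<Rightarrow> 'i \<Rightarrow> 'j \<Rightarrow> 'a \<Rightarrow> 's"
    and signal_prob :: "'s \<Rightarrow> 'i \<Rightarrow> 'j \<Rightarrow> 'a \<Rightarrow> real"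
  assumes belief_sum: "\<And>s. (\<Sum>k\<in>UNIV. belief s k) = 1"
    and signal_prob_nonneg: "\<And>s i j a. 0 \<le> signal_prob s i j a"
    and bayes: "\<And>s i j k' a. (\<Sum>k\<in>UNIV. belief s k * pmf (trans G k i j) (k', a)) =
      signal_prob s i j a * belief (upd s i j a) k'"
begin

definition public_state :: "'s \<Rightarrow> ('i \<times> 'j \<times> 'a) list \<Rightarrow> 's" where
  "public_state s h = foldl (\<lambda>s (i, j, a). upd s i j a) s h"

text \<open>
  The one-stage Shapley operator of the game on public states, at a fixed pair of actions.
\<close>

definition shapley :: "real \<Rightarrow> ('s \<Rightarrow> real) \<Rightarrow> 's \<Rightarrow> 'i \<Rightarrow> 'j \<Rightarrow> real" where
  "shapley l V s i j = l * (\<Sum>k\<in>UNIV. belief s k * payoff G k i j) +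
     (1 - l) * (\<Sum>a\<in>UNIV. signal_prob s i j a * V (upd s i j a))"

lemma public_state_snoc: "public_state s (h @ [(i, j, a)]) = upd (public_state s h) i j a"
  by (simp add: public_state_def)

lemma signal_prob_sum: "(\<Sum>a\<in>UNIV. signal_prob s i j a) = 1"
proof -
  have "(\<Sum>a\<in>UNIV. signal_prob s i j a) =
      (\<Sum>a\<in>UNIV. \<Sum>k'\<in>UNIV. signal_prob s i j a * belief (upd s i j a) k')"
    by (simp add: sum_distrib_left[symmetric] belief_sum)
  also have "\<dots> = (\<Sum>a\<in>UNIV. \<Sum>k'\<in>UNIV. \<Sum>k\<in>UNIV. belief s k * pmf (trans G k i j) (k', a))"
    by (simp add: bayes)
  also have "\<dots> = (\<Sum>a\<in>UNIV. \<Sum>k\<in>UNIV. \<Sum>k'\<in>UNIV. belief s k * pmf (trans G k i j) (k', a))"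
    by (intro sum.cong refl sum.swap)
  also have "\<dots> = (\<Sum>k\<in>UNIV. \<Sum>a\<in>UNIV. \<Sum>k'\<in>UNIV. belief s k * pmf (trans G k i j) (k', a))"
    by (rule sum.swap)
  also have "\<dots> = (\<Sum>k\<in>UNIV. belief s k * (\<Sum>k'\<in>UNIV. \<Sum>a\<in>UNIV. pmf (trans G k i j) (k', a)))"
    unfolding sum_distrib_left by (intro sum.cong refl sum.swap)
  also have "\<dots> = (\<Sum>k\<in>UNIV. belief s k * (\<Sum>x\<in>UNIV. pmf (trans G k i j) x))"
    by (simp add: sum.cartesian_product split_def)
  also have "\<dots> = 1"
    by (simp add: sum_pmf_eq_1 belief_sum)
  finally show ?thesis .
qed

text \<open>
  Averaging the state-wise recursion against a belief turns the transition probabilities into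
  Bayes' rule, so that the average after one stage is again an average against a labelled belief.
\<close>

lemma expected_horizon_payoff_Suc:
  "(\<Sum>k\<in>UNIV. belief s k * horizon_payoff G l \<sigma> \<tau> (Suc n) h k) =
    (\<integral>i. (\<integral>j. l * (\<Sum>k\<in>UNIV. belief s k * payoff G k i j) +
      (1 - l) * (\<Sum>a\<in>UNIV. signal_prob s i j a *
        (\<Sum>k\<in>UNIV. belief (upd s i j a) k * horizon_payoff G l \<sigma> \<tau> n (h @ [(i, j, a)]) k))
      \<partial>\<tau> h) \<partial>\<sigma> h)"
proof -
  let ?J = "\<lambda>i j a. horizon_payoff G l \<sigma> \<tau> n (h @ [(i, j, a)])"
  have trans: "(\<integral>x. (case x of (k', a) \<Rightarrow> ?J i j a k') \<partial>trans G k i j) =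
      (\<Sum>a\<in>UNIV. \<Sum>k'\<in>UNIV. pmf (trans G k i j) (k', a) * ?J i j a k')" for k i j
    by (subst sum.swap)
       (simp add: integral_measure_pmf[of UNIV] sum.cartesian_product split_def)
  have stage: "horizon_payoff G l \<sigma> \<tau> (Suc n) h k =
      (\<integral>i. (\<integral>j. l * payoff G k i j + (1 - l) *
        (\<Sum>a\<in>UNIV. \<Sum>k'\<in>UNIV. pmf (trans G k i j) (k', a) * ?J i j a k') \<partial>\<tau> h) \<partial>\<sigma> h)" for k
    unfolding horizon_payoff.simps stage_pmf_def integral_bind_finite_pmf integral_map_pmf
    by (simp add: split_def integral_finite_pmf_add_mult trans[unfolded split_def])
  have push: "(\<Sum>k\<in>UNIV. belief s k * (\<integral>x. f k x \<partial>p)) = (\<integral>x. (\<Sum>k\<in>UNIV. belief s k * f k x) \<partial>p)"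
    for p :: "'z::finite pmf" and f :: "'k \<Rightarrow> 'z \<Rightarrow> real"
    by (subst Bochner_Integration.integral_sum)
       (auto simp: integrable_measure_pmf_finite)
  have "(\<Sum>k\<in>UNIV. belief s k * (\<Sum>a\<in>UNIV. \<Sum>k'\<in>UNIV. pmf (trans G k i j) (k', a) * ?J i j a k')) =
      (\<Sum>a\<in>UNIV. signal_prob s i j a * (\<Sum>k\<in>UNIV. belief (upd s i j a) k * ?J i j a k))" for i j
  proof -
    have "(\<Sum>k\<in>UNIV. belief s k * (\<Sum>a\<in>UNIV. \<Sum>k'\<in>UNIV. pmf (trans G k i j) (k', a) * ?J i j a k')) =
        (\<Sum>k\<in>UNIV. \<Sum>a\<in>UNIV. \<Sum>k'\<in>UNIV. belief s k * pmf (trans G k i j) (k', a) * ?J i j a k')"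
      by (simp add: sum_distrib_left mult_ac)
    also have "\<dots> = (\<Sum>a\<in>UNIV. \<Sum>k\<in>UNIV. \<Sum>k'\<in>UNIV. belief s k * pmf (trans G k i j) (k', a) * ?J i j a k')"
      by (rule sum.swap)
    also have "\<dots> = (\<Sum>a\<in>UNIV. \<Sum>k'\<in>UNIV. \<Sum>k\<in>UNIV. belief s k * pmf (trans G k i j) (k', a) * ?J i j a k')"
      by (intro sum.cong refl sum.swap)
    also have "\<dots> = (\<Sum>a\<in>UNIV. signal_prob s i j a * (\<Sum>k\<in>UNIV. belief (upd s i j a) k * ?J i j a k))"
      unfolding sum_distrib_right[symmetric] bayes by (simp add: sum_distrib_left mult_ac)
    finally show ?thesis .
  qed
  then show ?thesis
    unfolding stage push
    by (simp add: sum.distrib distrib_left sum_distrib_left[symmetric] mult.left_commute[of "belief s _"])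
qed

text \<open>
  If Player 2 plays as a function of the public state and no action of Player 1 can then make
  the Shapley operator exceed \<open>V\<close>, the potential \<open>V\<close> bounds every finite-horizon payoff: by induction on the horizon,
  where \<open>0 \<le> V\<close> starts the induction. Player 1 may use the full history, since his choice at
  \<open>h\<close> only averages inequalities that hold for each action.
\<close>

lemma disc_payoff_le_superharmonic:
  assumes l: "0 < l" "l \<le> 1"
    and V_nonneg: "\<And>s. 0 \<le> V s"
    and V: "\<And>s i. shapley l V s i (act s) \<le> V s"
    and p: "\<And>k. pmf p k = belief s\<^sub>0 k"
  shows "disc_payoff G l p \<sigma> (\<lambda>h. return_pmf (act (public_state s\<^sub>0 h))) \<le> V s\<^sub>0"
proof -
  let ?\<tau> = "\<lambda>h. return_pmf (act (public_state s\<^sub>0 h))"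
  have J: "(\<Sum>k\<in>UNIV. belief (public_state s\<^sub>0 h) k * horizon_payoff G l \<sigma> ?\<tau> n h k)
      \<le> V (public_state s\<^sub>0 h)" for n h
  proof (induction n arbitrary: h)
    case 0
    show ?case by (simp add: V_nonneg)
  next
    case (Suc n)
    define s where "s = public_state s\<^sub>0 h"
    let ?J = "\<lambda>i a. \<Sum>k\<in>UNIV. belief (upd s i (act s) a) k *
      horizon_payoff G l \<sigma> ?\<tau> n (h @ [(i, act s, a)]) k"
    have "l * (\<Sum>k\<in>UNIV. belief s k * payoff G k i (act s)) +
        (1 - l) * (\<Sum>a\<in>UNIV. signal_prob s i (act s) a * ?J i a) \<le> V s" for i
    proof -
      have "?J i a \<le> V (upd s i (act s) a)" for a
        using Suc.IH[of "h @ [(i, act s, a)]"] by (simp add: public_state_snoc s_def)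
      then show ?thesis
        using l signal_prob_nonneg
        by (intro order_trans[OF _ V[of s i]])
           (auto simp: shapley_def intro!: add_left_mono mult_left_mono sum_mono)
    qed
    then show ?case
      unfolding expected_horizon_payoff_Suc s_def[symmetric]
      by (auto intro!: measure_pmf.integral_le_const integrable_measure_pmf_finite AE_I2)
  qed
  have "(\<integral>k. horizon_payoff G l \<sigma> ?\<tau> n [] k \<partial>measure_pmf p) \<le> V s\<^sub>0" for n
    using J[of "[]" n] by (simp add: integral_measure_pmf[of UNIV] p public_state_def)
  then show ?thesis
    by (intro LIMSEQ_le_const2[OF disc_payoff_horizon_limit[OF l]]) auto
qed

text \<open>
  The dual statement. A finite horizon may lose the continuation payoff, which \<open>V \<le> 1\<close> bounds by
  \<open>(1 - l) ^ n\<close>; this loss vanishes as the horizon grows.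
\<close>

lemma disc_payoff_ge_subharmonic:
  assumes l: "0 < l" "l \<le> 1"
    and V_le: "\<And>s. V s \<le> 1"
    and V: "\<And>s j. V s \<le> shapley l V s (act s) j"
    and p: "\<And>k. pmf p k = belief s\<^sub>0 k"
  shows "V s\<^sub>0 \<le> disc_payoff G l p (\<lambda>h. return_pmf (act (public_state s\<^sub>0 h))) \<tau>"
proof -
  let ?\<sigma> = "\<lambda>h. return_pmf (act (public_state s\<^sub>0 h))"
  have J: "V (public_state s\<^sub>0 h) - (1 - l) ^ n \<le>
    (\<Sum>k\<in>UNIV. belief (public_state s\<^sub>0 h) k * horizon_payoff G l ?\<sigma> \<tau> n h k)" for n h
  proof (induction n arbitrary: h)
    case 0
    show ?case using V_le by simp
  next
    case (Suc n)
    define s where "s = public_state s\<^sub>0 h"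
    let ?J = "\<lambda>j a. \<Sum>k\<in>UNIV. belief (upd s (act s) j a) k *
      horizon_payoff G l ?\<sigma> \<tau> n (h @ [(act s, j, a)]) k"
    have "V s - (1 - l) ^ Suc n \<le> l * (\<Sum>k\<in>UNIV. belief s k * payoff G k (act s) j) +
        (1 - l) * (\<Sum>a\<in>UNIV. signal_prob s (act s) j a * ?J j a)" for j
    proof -
      have "V (upd s (act s) j a) - (1 - l) ^ n \<le> ?J j a" for a
        using Suc.IH[of "h @ [(act s, j, a)]"] by (simp add: public_state_snoc s_def)
      then have "(1 - l) * (\<Sum>a\<in>UNIV. signal_prob s (act s) j a * (V (upd s (act s) j a) - (1 - l) ^ n))
          \<le> (1 - l) * (\<Sum>a\<in>UNIV. signal_prob s (act s) j a * ?J j a)"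
        using l signal_prob_nonneg by (intro mult_left_mono sum_mono) auto
      moreover have "(\<Sum>a\<in>UNIV. signal_prob s (act s) j a * (V (upd s (act s) j a) - (1 - l) ^ n)) =
          (\<Sum>a\<in>UNIV. signal_prob s (act s) j a * V (upd s (act s) j a)) - (1 - l) ^ n"
        by (simp add: right_diff_distrib sum_subtractf sum_distrib_right[symmetric] signal_prob_sum)
      ultimately show ?thesis
        using V[of s j] by (simp add: shapley_def right_diff_distrib)
    qed
    then show ?case
      unfolding expected_horizon_payoff_Suc s_def[symmetric]
      by (auto intro!: measure_pmf.integral_ge_const integrable_measure_pmf_finite AE_I2)
  qed
  have "V s\<^sub>0 - (1 - l) ^ n \<le> (\<integral>k. horizon_payoff G l ?\<sigma> \<tau> n [] k \<partial>measure_pmf p)" for n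
    using J[of "[]" n] by (simp add: integral_measure_pmf[of UNIV] p public_state_def)
  moreover have "(\<lambda>n. V s\<^sub>0 - (1 - l) ^ n) \<longlonglongrightarrow> V s\<^sub>0 - 0"
    using l by (intro tendsto_intros LIMSEQ_realpow_zero) auto
  ultimately show ?thesis
    using LIMSEQ_le[OF _ disc_payoff_horizon_limit[OF l]] by fastforce
qed

end

section \<open>The public beliefs of the game\<close>

text \<open>
  Under \<open>C\<close> the signal is \<open>D\<close> or \<open>D'\<close> with probability \<open>1/2\<close> in every state that is
  not absorbing, so the signal itself carries no information; but \<open>D'\<close> moves the state
  back to the \<open>++\<close> state of its side.
  Therefore the belief depends only on the side and on the number \<open>m\<close> of signals \<open>D\<close> since
  the last time the state was known. Quitting reveals the state: \<open>D'\<close> means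
  absorption, \<open>D\<close> means the \<open>++\<close> state of the other side.
\<close>

datatype public = One_side nat | Zero_side nat | Won | Lost

text \<open>
  The probability of absorption when the controlling player quits after \<open>m\<close> consecutive signals
  \<open>D\<close>. On the side with payoff 1 it takes two signals to divide this risk by four, and the first
  of them, which leads from \<open>OnePP\<close> to \<open>OneT\<close>, does not reduce it. This is the only asymmetry
  between the players.
\<close>

definition one_risk :: "nat \<Rightarrow> real" where
  "one_risk m = (1/4) ^ (m div 2)"

definition zero_risk :: "nat \<Rightarrow> real" where
  "zero_risk m = (1/2) ^ m"

text \<open>
  On the side with payoff 1 the dangerous state alternates: it is \<open>OnePP\<close> after an even and \<open>OneT\<close>
  after an odd number of signals \<open>D\<close>.
\<close>

fun public_law :: "public \<Rightarrow> state \<Rightarrow> real" where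
  "public_law (One_side m) k =
    (if k = (if even m then OnePP else OneT) then one_risk m
     else if k = OneP then 1 - one_risk m else 0)"
| "public_law (Zero_side m) k =
    (if k = ZeroPP then zero_risk m else if k = ZeroP then 1 - zero_risk m else 0)"
| "public_law Won k = (if k = OneStar then 1 else 0)"
| "public_law Lost k = (if k = ZeroStar then 1 else 0)"

fun public_next :: "public \<Rightarrow> action \<Rightarrow> action \<Rightarrow> signal \<Rightarrow> public" where
  "public_next (One_side m) _ C D = One_side (Suc m)"
| "public_next (One_side m) _ C D' = One_side 0"
| "public_next (One_side m) _ Q D = Zero_side 0"
| "public_next (One_side m) _ Q D' = Won"
| "public_next (Zero_side m) C _ D = Zero_side (Suc m)"
| "public_next (Zero_side m) C _ D' = Zero_side 0"
| "public_next (Zero_side m) Q _ D = One_side 0"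
| "public_next (Zero_side m) Q _ D' = Lost"
| "public_next Won _ _ _ = Won"
| "public_next Lost _ _ _ = Lost"

fun public_signal :: "public \<Rightarrow> action \<Rightarrow> action \<Rightarrow> signal \<Rightarrow> real" where
  "public_signal (One_side m) _ C _ = 1/2"
| "public_signal (One_side m) _ Q D = 1 - one_risk m"
| "public_signal (One_side m) _ Q D' = one_risk m"
| "public_signal (Zero_side m) C _ _ = 1/2"
| "public_signal (Zero_side m) Q _ D = 1 - zero_risk m"
| "public_signal (Zero_side m) Q _ D' = zero_risk m"
| "public_signal Won _ _ D = 1"
| "public_signal Won _ _ D' = 0"
| "public_signal Lost _ _ D = 1"
| "public_signal Lost _ _ D' = 0"

lemma one_risk_0 [simp]: "one_risk 0 = 1"
  and zero_risk_0 [simp]: "zero_risk 0 = 1"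
  and zero_risk_Suc [simp]: "zero_risk (Suc m) = zero_risk m / 2"
  and one_risk_nonneg [simp]: "0 \<le> one_risk m"
  and zero_risk_nonneg [simp]: "0 \<le> zero_risk m"
  and one_risk_le_1 [simp]: "one_risk m \<le> 1"
  and zero_risk_le_1 [simp]: "zero_risk m \<le> 1"
  by (simp_all add: one_risk_def zero_risk_def power_le_one)

lemma one_risk_Suc_even: "even m \<Longrightarrow> one_risk (Suc m) = one_risk m"
  and one_risk_Suc_odd: "odd m \<Longrightarrow> one_risk (Suc m) = one_risk m / 4"
  by (auto simp: one_risk_def elim!: evenE oddE)

lemma one_risk_mono: "m \<le> n \<Longrightarrow> one_risk n \<le> one_risk m"
  and zero_risk_mono: "m \<le> n \<Longrightarrow> zero_risk n \<le> zero_risk m"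
  unfolding one_risk_def zero_risk_def by (intro power_decreasing div_le_mono; simp)+

lemma pmf_trans_\<Gamma>:
  "pmf (trans \<Gamma> k i j) z =
    (\<Sum>y\<leftarrow>controlled_law k (if k \<in> {OnePP, OneT, OneP} then j else i). if fst y = z then snd y else 0)"
  unfolding \<Gamma>_def by (simp add: pmf_pmf_of_list[OF controlled_law_wf] sum_list_map_filter' del: insert_iff)

lemma bayes_One_side:
  "(\<Sum>k\<in>UNIV. public_law (One_side m) k * pmf (trans \<Gamma> k i j) (k', a)) =
    public_signal (One_side m) i j a * public_law (public_next (One_side m) i j a) k'"
proof (cases "even m")
  case True
  then show ?thesis
    by (cases j; cases a; cases k')
       (simp_all add: UNIV_state pmf_trans_\<Gamma> one_risk_Suc_even field_simps)
next
  case False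
  then show ?thesis
    by (cases j; cases a; cases k')
       (simp_all add: UNIV_state pmf_trans_\<Gamma> one_risk_Suc_odd field_simps)
qed

lemma bayes_Zero_side:
  "(\<Sum>k\<in>UNIV. public_law (Zero_side m) k * pmf (trans \<Gamma> k i j) (k', a)) =
    public_signal (Zero_side m) i j a * public_law (public_next (Zero_side m) i j a) k'"
  by (cases i; cases a; cases k') (simp_all add: UNIV_state pmf_trans_\<Gamma> field_simps)

lemma public_belief_\<Gamma>: "public_belief \<Gamma> public_law public_next public_signal"
proof
  fix s i j a k'
  show "(\<Sum>k\<in>UNIV. public_law s k) = 1"
    by (cases s) (simp_all add: UNIV_state)
  show "0 \<le> public_signal s i j a"
    by (cases s; cases i; cases j; cases a) simp_all
  show "(\<Sum>k\<in>UNIV. public_law s k * pmf (trans \<Gamma> k i j) (k', a)) =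
      public_signal s i j a * public_law (public_next s i j a) k'"
  proof (cases s)
    case (One_side m)
    then show ?thesis by (simp only: bayes_One_side)
  next
    case (Zero_side m)
    then show ?thesis by (simp only: bayes_Zero_side)
  next
    case Won
    show ?thesis unfolding Won
      by (cases a; cases k') (simp_all add: UNIV_state pmf_trans_\<Gamma>)
  next
    case Lost
    show ?thesis unfolding Lost
      by (cases a; cases k') (simp_all add: UNIV_state pmf_trans_\<Gamma>)
  qed
qed

abbreviation shapley_\<Gamma> :: "real \<Rightarrow> (public \<Rightarrow> real) \<Rightarrow> public \<Rightarrow> action \<Rightarrow> action \<Rightarrow> real" where
  "shapley_\<Gamma> \<equiv> public_belief.shapley \<Gamma> public_law public_next public_signal"

lemma payoff_\<Gamma>:
  "payoff \<Gamma> k i j = (if k \<in> {OneStar, OnePP, OneT, OneP} then 1 else 0)"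
  by (simp add: \<Gamma>_def)

lemma shapley_One_side:
  "shapley_\<Gamma> l V (One_side m) i C = l + (1 - l) * (V (One_side (Suc m)) + V (One_side 0)) / 2"
  "shapley_\<Gamma> l V (One_side m) i Q =
    l + (1 - l) * ((1 - one_risk m) * V (Zero_side 0) + one_risk m * V Won)"
  and shapley_Zero_side:
  "shapley_\<Gamma> l V (Zero_side m) C j = (1 - l) * (V (Zero_side (Suc m)) + V (Zero_side 0)) / 2"
  "shapley_\<Gamma> l V (Zero_side m) Q j =
    (1 - l) * ((1 - zero_risk m) * V (One_side 0) + zero_risk m * V Lost)"
  and shapley_absorbed:
  "shapley_\<Gamma> l V Won i j = l + (1 - l) * V Won"
  "shapley_\<Gamma> l V Lost i j = (1 - l) * V Lost"
  by (simp_all add: public_belief.shapley_def[OF public_belief_\<Gamma>] UNIV_state UNIV_signal payoff_\<Gamma> field_simps)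

section \<open>Waiting and quitting\<close>

text \<open>
  The discount factor lost by waiting. Let \<open>T\<close> be the number of stages until \<open>m\<close> consecutive
  signals \<open>D\<close> have been seen, when both signals have probability \<open>1/2\<close> at each stage; then
  \<open>delay l m\<close> is the inverse of the expectation of \<open>(1 - l) ^ T\<close>. Equivalently, a function
  of \<open>m\<close> that is preserved in expectation, after discounting, while waiting is its value at \<open>0\<close>
  times \<open>delay l m\<close>; \<open>delay_rec\<close> is this property.
\<close>

definition delay :: "real \<Rightarrow> nat \<Rightarrow> real" where
  "delay l m = ((1 - l) + 2 * l * (2 / (1 - l)) ^ m) / (1 + l)"

lemma delay_eq: "0 < l \<Longrightarrow> (1 + l) * delay l m = 1 - l + 2 * l * (2 / (1 - l)) ^ m"
  by (simp add: delay_def)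

lemma delay_0: "0 < l \<Longrightarrow> delay l 0 = 1"
  by (simp add: delay_def)

lemma delay_rec:
  assumes "0 < l" "l < 1"
  shows "(1 - l) * (delay l (Suc m) + 1) / 2 = delay l m"
proof -
  define q where "q = (2 / (1 - l)) ^ m"
  define q' where "q' = (2 / (1 - l)) ^ Suc m"
  have "(1 - l) * q' = 2 * q"
    using assms by (simp add: q_def q'_def)
  moreover have "(1 + l) * delay l m = 1 - l + 2 * l * q" "(1 + l) * delay l (Suc m) = 1 - l + 2 * l * q'"
    using assms unfolding q_def q'_def by (simp_all only: delay_eq)
  ultimately have "(1 + l) * ((1 - l) * (delay l (Suc m) + 1)) = (1 + l) * (2 * delay l m)"
    by algebra
  then show ?thesis using assms by simp
qed

lemma delay_ge_1:
  assumes "0 < l" "l < 1"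
  shows "1 \<le> delay l m"
proof -
  have "1 \<le> (2 / (1 - l)) ^ m"
    using assms by (intro one_le_power) (simp add: field_simps)
  then have "l * 1 \<le> l * (2 / (1 - l)) ^ m"
    using assms by (intro mult_left_mono) auto
  then have "(1 + l) * 1 \<le> (1 + l) * delay l m"
    unfolding delay_eq[OF assms(1)] by argo
  then show ?thesis
    using assms by (simp only: mult_le_cancel_left_pos)
qed

lemma delay_mono:
  assumes l: "0 < l" "l < 1" and "m \<le> n"
  shows "delay l m \<le> delay l n"
proof (rule lift_Suc_mono_le[OF _ \<open>m \<le> n\<close>])
  fix m
  have "(1 - l) * (delay l (Suc m) + 1) \<le> 1 * (delay l (Suc m) + 1)"
    using l delay_ge_1[OF l, of "Suc m"] by (intro mult_right_mono) auto
  then have "delay l m \<le> (delay l (Suc m) + 1) / 2"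
    by (subst delay_rec[OF l, symmetric]) simp
  then show "delay l m \<le> delay l (Suc m)"
    using delay_ge_1[OF l, of "Suc m"] by simp
qed

text \<open>
  Let \<open>x\<close> and \<open>y\<close> be the values of a potential at \<open>OnePP\<close> and \<open>ZeroPP\<close>. Player 2 waits for
  \<open>N\<close> consecutive signals \<open>D\<close> and then quits; by the inequality for \<open>A\<close> this gives him
  \<open>1 - x \<ge> A * (1 - y)\<close>. By the inequality for \<open>\<beta>\<close> no waiting time lets Player 1 obtain more
  than \<open>y = \<beta> * x\<close>. Solving the two equations gives \<open>x = (1 - A) / (1 - A * \<beta>)\<close>. The
  potential is the solution of these equations, propagated along waiting by \<open>delay\<close>.
\<close>

lemma disc_value_le_of_patience:
  assumes l: "0 < l" "l < 1" and A: "0 \<le> A" "A < 1" and \<beta>: "0 \<le> \<beta>" "\<beta> \<le> 1"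
    and two: "A * delay l N \<le> (1 - l) * (1 - one_risk N)"
    and one: "\<And>m. (1 - l) * (1 - zero_risk m) \<le> \<beta> * delay l m"
  shows "disc_value \<Gamma> l (return_pmf OnePP) \<le> (1 - A) / (1 - A * \<beta>)"
proof -
  have A\<beta>: "A * \<beta> < 1" "A * \<beta> \<le> A"
    using A \<beta> mult_left_mono[of \<beta> 1 A] by auto
  define x where "x = (1 - A) / (1 - A * \<beta>)"
  have x: "0 \<le> x" "x \<le> 1" "1 - A * (1 - \<beta> * x) = x"
    using A A\<beta> by (simp_all add: x_def field_simps)
  have y: "0 \<le> \<beta> * x" "\<beta> * x \<le> 1"
    using x \<beta> by (auto intro: mult_le_one)
  \<comment> \<open>The waiting time is cut off at \<open>N\<close> because larger counts occur off the path of Player 2's strategy only.\<close>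
  define V where "V s = (case s of One_side m \<Rightarrow> 1 - A * (1 - \<beta> * x) * delay l (min m N)
    | Zero_side m \<Rightarrow> \<beta> * x * delay l m | Won \<Rightarrow> 1 | Lost \<Rightarrow> 0)" for s
  define act where "act s = (case s of One_side m \<Rightarrow> if m < N then C else Q | _ \<Rightarrow> C)" for s
  have V0: "V (One_side 0) = x" "V (Zero_side 0) = \<beta> * x"
    using x l by (simp_all add: V_def delay_0)
  \<comment> \<open>Quitting later than planned is no more risky, hence the plan's bound also holds there.\<close>
  have quit: "(1 - \<beta> * x) * (A * delay l N) \<le> (1 - \<beta> * x) * ((1 - l) * (1 - one_risk m))"
    if "N \<le> m" for m
    using one_risk_mono[OF that] two y l
    by (intro mult_left_mono order_trans[OF two]) auto
  have "shapley_\<Gamma> l V s i (act s) \<le> V s" for s i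
  proof (cases s)
    case (One_side m)
    show ?thesis
    proof (cases "m < N")
      case True
      have "l + (1 - l) * (1 - A * (1 - \<beta> * x) * delay l (Suc m) + (1 - A * (1 - \<beta> * x))) / 2 =
          1 - A * (1 - \<beta> * x) * ((1 - l) * (delay l (Suc m) + 1) / 2)"
        by (simp add: field_simps)
      then show ?thesis
        using True unfolding One_side delay_rec[OF l]
        by (simp add: act_def shapley_One_side V0 x(3)) (simp add: V_def x(3))
    next
      case False
      then show ?thesis using quit[of m]
        unfolding One_side
        by (simp add: act_def shapley_One_side V0) (simp add: V_def algebra_simps)
    qed
  next
    case (Zero_side m)
    have "x * ((1 - l) * (1 - zero_risk m)) \<le> x * (\<beta> * delay l m)"
      by (intro mult_left_mono one x)
    moreover have "(1 - l) * (\<beta> * x * delay l (Suc m) + \<beta> * x) / 2 =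
        \<beta> * x * ((1 - l) * (delay l (Suc m) + 1) / 2)"
      by (simp add: field_simps)
    ultimately show ?thesis
      unfolding Zero_side delay_rec[OF l]
      by (cases i) (simp_all add: shapley_Zero_side V0, simp_all add: V_def mult_ac)
  qed (simp_all add: shapley_absorbed V_def)
  moreover have "0 \<le> V s" for s
  proof (cases s)
    case (One_side m)
    have "(1 - \<beta> * x) * (A * delay l (min m N)) \<le> (1 - \<beta> * x) * (A * delay l N)"
      using A y by (intro mult_left_mono delay_mono l) auto
    also have "\<dots> \<le> (1 - \<beta> * x) * ((1 - l) * (1 - one_risk N))"
      by (rule quit) simp
    also have "\<dots> \<le> 1"
      using l y by (intro mult_le_one mult_nonneg_nonneg) auto
    finally show ?thesis
      by (simp add: One_side V_def mult_ac)
  next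
    case (Zero_side m)
    then show ?thesis using y delay_ge_1[OF l, of m] by (simp add: V_def)
  qed (simp_all add: V_def)
  moreover have "pmf (return_pmf OnePP) k = public_law (One_side 0) k" for k
    by (simp add: indicator_def)
  ultimately have "disc_value \<Gamma> l (return_pmf OnePP) \<le> V (One_side 0)"
    using l by (intro disc_value_le[OF _ _ public_belief.disc_payoff_le_superharmonic[OF public_belief_\<Gamma>, where act = act]]) auto
  then show ?thesis by (simp add: V0 x_def)
qed

text \<open>
  The same argument with the players exchanged: Player 1 waits for \<open>N\<close> consecutive signals and
  obtains \<open>y = A * x\<close>, while Player 2 cannot do better than \<open>1 - x = \<beta> * (1 - y)\<close>.
\<close>

lemma disc_value_ge_of_patience:
  assumes l: "0 < l" "l < 1" and A: "0 \<le> A" "A < 1" and \<beta>: "0 \<le> \<beta>" "\<beta> \<le> 1"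
    and one: "A * delay l N \<le> (1 - l) * (1 - zero_risk N)"
    and two: "\<And>m. (1 - l) * (1 - one_risk m) \<le> \<beta> * delay l m"
  shows "(1 - \<beta>) / (1 - A * \<beta>) \<le> disc_value \<Gamma> l (return_pmf OnePP)"
proof -
  have A\<beta>: "A * \<beta> < 1" "A * \<beta> \<le> \<beta>"
    using A \<beta> mult_left_mono[of \<beta> 1 A] mult_right_mono[of A 1 \<beta>] by auto
  define x where "x = (1 - \<beta>) / (1 - A * \<beta>)"
  have x: "0 \<le> x" "x \<le> 1" "1 - \<beta> * (1 - A * x) = x"
    using \<beta> A\<beta> by (simp_all add: x_def field_simps)
  have y: "0 \<le> A * x" "A * x \<le> 1"
    using x A by (auto intro: mult_le_one)
  define V where "V s = (case s of One_side m \<Rightarrow> 1 - \<beta> * (1 - A * x) * delay l m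
    | Zero_side m \<Rightarrow> A * x * delay l (min m N) | Won \<Rightarrow> 1 | Lost \<Rightarrow> 0)" for s
  define act where "act s = (case s of Zero_side m \<Rightarrow> if m < N then C else Q | _ \<Rightarrow> C)" for s
  have V0: "V (One_side 0) = x" "V (Zero_side 0) = A * x"
    using x l by (simp_all add: V_def delay_0)
  have quit: "x * (A * delay l N) \<le> x * ((1 - l) * (1 - zero_risk m))" if "N \<le> m" for m
    using zero_risk_mono[OF that] one x l
    by (intro mult_left_mono order_trans[OF one]) auto
  have "V s \<le> shapley_\<Gamma> l V s (act s) j" for s j
  proof (cases s)
    case (One_side m)
    have "(1 - A * x) * ((1 - l) * (1 - one_risk m)) \<le> (1 - A * x) * (\<beta> * delay l m)"
      using y by (intro mult_left_mono two) auto
    moreover have "l + (1 - l) * (1 - \<beta> * (1 - A * x) * delay l (Suc m) + (1 - \<beta> * (1 - A * x))) / 2 =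
        1 - \<beta> * (1 - A * x) * ((1 - l) * (delay l (Suc m) + 1) / 2)"
      by (simp add: field_simps)
    ultimately show ?thesis
      unfolding One_side delay_rec[OF l]
      by (cases j) (simp_all add: shapley_One_side V0 x(3), simp_all add: V_def algebra_simps)
  next
    case (Zero_side m)
    show ?thesis
    proof (cases "m < N")
      case True
      have "(1 - l) * (A * x * delay l (Suc m) + A * x) / 2 =
          A * x * ((1 - l) * (delay l (Suc m) + 1) / 2)"
        by (simp add: field_simps)
      then show ?thesis
        using True unfolding Zero_side delay_rec[OF l]
        by (simp add: act_def shapley_Zero_side V0) (simp add: V_def)
    next
      case False
      then show ?thesis
        using quit[of m] unfolding Zero_side
        by (simp add: act_def shapley_Zero_side V0) (simp add: V_def mult_ac)
    qed
  qed (simp_all add: shapley_absorbed V_def)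
  moreover have "V s \<le> 1" for s
  proof (cases s)
    case (One_side m)
    then show ?thesis using y \<beta> delay_ge_1[OF l, of m] by (simp add: V_def)
  next
    case (Zero_side m)
    have "x * (A * delay l (min m N)) \<le> x * (A * delay l N)"
      using A x by (intro mult_left_mono delay_mono l) auto
    also have "\<dots> \<le> x * ((1 - l) * (1 - zero_risk N))"
      by (rule quit) simp
    also have "\<dots> \<le> 1"
      using l x by (intro mult_le_one mult_nonneg_nonneg) auto
    finally show ?thesis
      by (simp add: Zero_side V_def mult_ac)
  qed (simp_all add: V_def)
  moreover have "pmf (return_pmf OnePP) k = public_law (One_side 0) k" for k
    by (simp add: indicator_def)
  ultimately have "V (One_side 0) \<le> disc_value \<Gamma> l (return_pmf OnePP)"
    using l by (intro disc_value_ge[OF _ _ public_belief.disc_payoff_ge_subharmonic[OF public_belief_\<Gamma>, where act = act]]) auto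
  then show ?thesis by (simp add: V0 x_def)
qed

section \<open>Optimal waiting times and the parity of their exponent\<close>

text \<open>
  In terms of \<open>s = (1/2) ^ N\<close> and \<open>l = s\<^sup>2 / 2\<close>, the two estimates for the factor
  \<open>(1 - l) * (1 - risk) / delay l m\<close> by which waiting for \<open>m\<close> signals and then quitting
  multiplies the quitter's prospects on the other side. \<open>quit_gain s\<close> is a lower estimate for
  \<open>m = N\<close> with risk \<open>s\<close>, and equals \<open>1 - 2 * s\<close> to first order; \<open>gain_bound c s\<close> is an upper
  estimate for all \<open>m\<close>, and equals \<open>1 - c * s\<close> to first order. The discount rate is chosen so that the
  cost \<open>2 * l * 2 ^ m\<close> of waiting and the risk \<open>1 / 2 ^ m\<close> are both equal to \<open>s\<close> at
  \<open>m = N\<close>, where their sum is minimal.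
\<close>

definition quit_gain :: "real \<Rightarrow> real" where
  "quit_gain s = (1 - s\<^sup>2 / 2) * (1 + s\<^sup>2 / 2) * (1 - s) / (1 - s\<^sup>2 / 2 + s / (1 - s / 2))"

definition gain_bound :: "real \<Rightarrow> real \<Rightarrow> real" where
  "gain_bound c s = (1 + s\<^sup>2 / 2) / (1 + c * s)"

text \<open>
  In \<open>delay l N\<close> the factor \<open>(1 - l) ^ N\<close> is the only one that is not a rational function of
  \<open>s\<close>. By Bernoulli's inequality it is at least \<open>1 - N * l\<close>, and \<open>N * s \<le> 1\<close> makes this at least
  \<open>1 - s / 2\<close>.
\<close>

lemma quit_gain_delay:
  assumes s: "s = (1/2) ^ N" and l: "l = s\<^sup>2 / 2"
  shows "quit_gain s * delay l N \<le> (1 - l) * (1 - s)"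
proof -
  have s01: "0 < s" "s \<le> 1" by (auto simp: s power_le_one)
  then have l01: "0 < l" "l \<le> 1/2" using power_le_one[of s 2] by (auto simp: l)
  have "real N * s \<le> 1"
    using of_nat_less_two_power[of N, where ?'a = real] by (simp add: s field_simps)
  then have "real N * l \<le> s / 2"
    using mult_left_mono[of "real N * s" 1 s] s01 by (simp add: l power2_eq_square mult_ac)
  then have r: "1 - s / 2 \<le> (1 - l) ^ N"
    using Bernoulli_inequality[of "- l" N] l01 by simp
  have "2 * l * (2 / (1 - l)) ^ N = s / (1 - l) ^ N"
    by (simp add: l s power_divide power2_eq_square)
  also have "\<dots> \<le> s / (1 - s / 2)"
    using s01 r by (intro divide_left_mono mult_pos_pos) auto
  finally have "(1 + l) * delay l N \<le> 1 - l + s / (1 - s / 2)"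
    using l01 by (simp add: delay_def)
  moreover have pos: "0 < 1 - l + s / (1 - s / 2)"
    using s01 l01 by (intro add_pos_pos divide_pos_pos) auto
  moreover have "0 \<le> (1 - l) * (1 - s) / (1 - l + s / (1 - s / 2))"
    using s01 l01 pos by (intro divide_nonneg_pos mult_nonneg_nonneg) auto
  ultimately have "(1 - l) * (1 - s) / (1 - l + s / (1 - s / 2)) * ((1 + l) * delay l N) \<le>
      (1 - l) * (1 - s) / (1 - l + s / (1 - s / 2)) * (1 - l + s / (1 - s / 2))"
    by (intro mult_left_mono)
  then show ?thesis
    using pos by (simp add: quit_gain_def flip: l) (simp add: field_simps)
qed

text \<open>
  With \<open>u = s * 2 ^ m\<close>, waiting for \<open>m\<close> signals costs about \<open>s * u\<close> and the risk of quitting is about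
  \<open>s / u\<close>; a lower bound \<open>c\<close> for \<open>u + 1 / u\<close> therefore bounds the total loss by \<open>c * s\<close> from
  below. A smaller \<open>u\<close> is allowed, since waiting longer than a given risk requires only
  adds to the cost.
\<close>

lemma gain_bound_delay:
  assumes s: "0 < s" "s \<le> 1" and l: "l = s\<^sup>2 / 2" and c: "0 \<le> c"
    and u: "0 < u" "u \<le> s * 2 ^ m" and risk: "s / u \<le> risk" and cu: "c \<le> u + 1 / u"
  shows "(1 - l) * (1 - risk) \<le> gain_bound c s * delay l m"
proof -
  have l01: "0 < l" "l \<le> 1/2" using s power_le_one[of s 2] by (auto simp: l)
  have "2 ^ m \<le> (2 / (1 - l)) ^ m"
    using l01 by (intro power_mono) (auto simp: field_simps)
  then have "s * (s * 2 ^ m) \<le> s * (s * (2 / (1 - l)) ^ m)"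
    using s by (intro mult_left_mono) auto
  moreover have "s * u \<le> s * (s * 2 ^ m)"
    using s u by (intro mult_left_mono) auto
  moreover have "(1 - l) * (s * u) \<le> 1 * (s * u)"
    using l01 s u by (intro mult_right_mono) auto
  moreover have "2 * l = s * s"
    by (simp add: l power2_eq_square)
  then have "(1 + l) * delay l m = 1 - l + s * (s * (2 / (1 - l)) ^ m)"
    using l01 by (simp add: delay_def mult.assoc)
  ultimately have "(1 - l) * (1 + s * u) \<le> (1 + l) * delay l m"
    by (simp add: distrib_left)
  note grow = this
  have "s * c \<le> s * (u + 1 / u)"
    using s cu by (intro mult_left_mono) auto
  moreover have "0 \<le> c * (s * s) / u"
    using s u c by simp
  ultimately have "(1 + c * s) * (1 - s / u) \<le> 1 + s * u"
    by (simp add: algebra_simps)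
  with l01 have "(1 - l) * ((1 + c * s) * (1 - s / u)) \<le> (1 - l) * (1 + s * u)"
    by (intro mult_left_mono) auto
  moreover note grow
  moreover have "(1 - l) * ((1 + c * s) * (1 - risk)) \<le> (1 - l) * ((1 + c * s) * (1 - s / u))"
    using l01 risk c s by (intro mult_left_mono) auto
  ultimately have "(1 - l) * ((1 + c * s) * (1 - risk)) \<le> (1 + l) * delay l m"
    by argo
  moreover have "0 < 1 + c * s" using c s by (simp add: add_pos_nonneg)
  ultimately show ?thesis
    by (simp add: gain_bound_def flip: l) (simp add: field_simps)
qed

lemma add_inverse_ge_2: "0 < u \<Longrightarrow> 2 \<le> u + 1 / u" for u :: real
  using zero_le_power2[of "u - 1"] by (simp add: field_simps power2_eq_square)

lemma add_inverse_ge_5_2: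
  fixes u :: real
  assumes "0 < u" "u \<le> 1/2 \<or> 2 \<le> u"
  shows "5/2 \<le> u + 1 / u"
proof -
  have "0 \<le> (u - 2) * (u - 1/2)"
    using assms by (auto intro: mult_nonneg_nonneg mult_nonpos_nonpos)
  then show ?thesis using assms by (simp add: field_simps)
qed

lemma gain_estimates_in_unit_interval:
  assumes s: "0 < s" "s \<le> 1" and c: "1 \<le> c"
  shows "0 \<le> quit_gain s" "quit_gain s < 1" "0 \<le> gain_bound c s" "gain_bound c s \<le> 1"
proof -
  define l where "l = s\<^sup>2 / 2"
  have l: "0 < l" "l < 1" "l < s"
    using s power_decreasing[of 1 2 s] by (auto simp: l_def)
  have D: "1 - l \<le> 1 - l + s / (1 - s / 2)"
    using s by simp
  then show "0 \<le> quit_gain s"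
    using s l unfolding quit_gain_def l_def[symmetric]
    by (intro divide_nonneg_nonneg mult_nonneg_nonneg) auto
  have "(1 + l) * (1 - s) = 1 + (l - s) - l * s" by (simp add: algebra_simps)
  also have "\<dots> < 1" using l mult_pos_pos[OF l(1) s(1)] by argo
  finally have "(1 - l) * ((1 + l) * (1 - s)) < (1 - l) * 1"
    using l by (intro mult_strict_left_mono) auto
  also have "\<dots> \<le> 1 - l + s / (1 - s / 2)"
    using D by simp
  finally show "quit_gain s < 1"
    using D l unfolding quit_gain_def l_def[symmetric]
    by (subst divide_less_eq_1_pos) (auto simp: mult.assoc)
  have "l \<le> 1 * s" using l by simp
  also have "\<dots> \<le> c * s"
    using c s by (intro mult_right_mono) auto
  finally show "0 \<le> gain_bound c s" "gain_bound c s \<le> 1"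
    using l c s unfolding gain_bound_def l_def[symmetric] by auto
qed

text \<open>
  For even \<open>N\<close> the optimal waiting time \<open>N\<close> is efficient for Player 2 as well, so both players lose
  at the rate \<open>2 * s\<close>.
\<close>

lemma disc_value_le_even:
  assumes "even N" "s = (1/2) ^ N"
  shows "disc_value \<Gamma> (s\<^sup>2 / 2) (return_pmf OnePP) \<le>
    (1 - quit_gain s) / (1 - quit_gain s * gain_bound 2 s)"
proof (rule disc_value_le_of_patience)
  have s: "0 < s" "s \<le> 1" using assms by (auto simp: power_le_one)
  then show "0 < s\<^sup>2 / 2" "s\<^sup>2 / 2 < 1" using power_le_one[of s 2] by auto
  show "0 \<le> quit_gain s" "quit_gain s < 1" "0 \<le> gain_bound 2 s" "gain_bound 2 s \<le> 1"
    using s by (auto intro: gain_estimates_in_unit_interval)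
  have "one_risk N = s"
    using assms by (auto simp: one_risk_def power_mult power2_eq_square elim!: evenE)
  then show "quit_gain s * delay (s\<^sup>2 / 2) N \<le> (1 - s\<^sup>2 / 2) * (1 - one_risk N)"
    using quit_gain_delay[OF assms(2) refl] by simp
  show "(1 - s\<^sup>2 / 2) * (1 - zero_risk m) \<le> gain_bound 2 s * delay (s\<^sup>2 / 2) m" for m
    by (rule gain_bound_delay[where u = "s * 2 ^ m"])
       (use s in \<open>auto simp: zero_risk_def power_divide intro!: add_inverse_ge_2\<close>)
qed

text \<open>
  For odd \<open>N\<close>, Player 2's risk after \<open>m\<close> signals is \<open>1 / 4 ^ (m div 2)\<close>, and \<open>2 ^ N\<close> lies at
  least a factor of two away from every power of four. So \<open>u\<close> avoids the interval between
  \<open>1/2\<close> and \<open>2\<close>, and Player 2 loses at the rate \<open>5/2 * s\<close> at best, against \<open>2 * s\<close> for Player 1.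
\<close>

lemma disc_value_ge_odd:
  assumes "odd N" "s = (1/2) ^ N"
  shows "(1 - gain_bound (5/2) s) / (1 - quit_gain s * gain_bound (5/2) s) \<le>
    disc_value \<Gamma> (s\<^sup>2 / 2) (return_pmf OnePP)"
proof (rule disc_value_ge_of_patience)
  have s: "0 < s" "s \<le> 1" using assms by (auto simp: power_le_one)
  then show "0 < s\<^sup>2 / 2" "s\<^sup>2 / 2 < 1" using power_le_one[of s 2] by auto
  show "0 \<le> quit_gain s" "quit_gain s < 1" "0 \<le> gain_bound (5/2) s" "gain_bound (5/2) s \<le> 1"
    using s by (auto intro: gain_estimates_in_unit_interval)
  show "quit_gain s * delay (s\<^sup>2 / 2) N \<le> (1 - s\<^sup>2 / 2) * (1 - zero_risk N)"
    using quit_gain_delay[OF assms(2) refl] by (simp add: zero_risk_def assms)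
  show "(1 - s\<^sup>2 / 2) * (1 - one_risk m) \<le> gain_bound (5/2) s * delay (s\<^sup>2 / 2) m" for m
  proof (rule gain_bound_delay[where u = "s * 4 ^ (m div 2)"])
    have pow: "(4::real) ^ (m div 2) = 2 ^ (2 * (m div 2))"
      by (simp add: power_mult)
    then show "s * 4 ^ (m div 2) \<le> s * 2 ^ m"
      using s by (auto intro!: mult_left_mono power_increasing)
    have "2 * (m div 2) < N \<or> N < 2 * (m div 2)"
      using \<open>odd N\<close> by (metis dvd_triv_left linorder_neqE_nat)
    then have "(2::real) ^ (2 * (m div 2)) * 2 \<le> 2 ^ N \<or> 2 * 2 ^ N \<le> (2::real) ^ (2 * (m div 2))"
      by (metis Suc_leI one_le_numeral power_Suc power_Suc2 power_increasing)
    then have "s * 4 ^ (m div 2) \<le> 1/2 \<or> 2 \<le> s * 4 ^ (m div 2)"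
      unfolding pow by (auto simp: assms power_divide field_simps)
    then show "5/2 \<le> s * 4 ^ (m div 2) + 1 / (s * 4 ^ (m div 2))"
      using s by (intro add_inverse_ge_5_2) auto
  qed (use s in \<open>auto simp: one_risk_def power_divide\<close>)
qed

text \<open>
  The limits are \<open>2 / (2 + 2)\<close> and \<open>5/2 / (5/2 + 2)\<close>: to first order in \<open>s\<close>, the value is the share of
  Player 2's rate of loss in the sum of both rates.
\<close>

lemma limit_even:
  "((\<lambda>s. (1 - quit_gain s) / (1 - quit_gain s * gain_bound 2 s)) \<longlongrightarrow> 1/2) (at_right 0)"
  unfolding quit_gain_def gain_bound_def by real_asymp

lemma limit_odd:
  "((\<lambda>s. (1 - gain_bound (5/2) s) / (1 - quit_gain s * gain_bound (5/2) s)) \<longlongrightarrow> 5/9) (at_right 0)"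
  unfolding quit_gain_def gain_bound_def by real_asymp

theorem theorem2p5:
  shows "\<not> (\<exists>w :: state pmf \<Rightarrow> real. \<forall>p. ((\<lambda>l. disc_value \<Gamma> l p) \<longlongrightarrow> w p) (at_right 0))"
proof
  assume "\<exists>w :: state pmf \<Rightarrow> real. \<forall>p. ((\<lambda>l. disc_value \<Gamma> l p) \<longlongrightarrow> w p) (at_right 0)"
  then obtain c where c: "((\<lambda>l. disc_value \<Gamma> l (return_pmf OnePP)) \<longlongrightarrow> c) (at_right 0)"
    by blast
  have even: "filterlim (\<lambda>n. (1/2) ^ (2 * n) :: real) (at_right 0) sequentially"
    and odd: "filterlim (\<lambda>n. (1/2) ^ (2 * n + 1) :: real) (at_right 0) sequentially"
    by real_asymp+
  have "filterlim (\<lambda>s::real. s\<^sup>2 / 2) (at_right 0) (at_right 0)"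
    by real_asymp
  then have c': "((\<lambda>s. disc_value \<Gamma> (s\<^sup>2 / 2) (return_pmf OnePP)) \<longlongrightarrow> c) (at_right 0)"
    by (rule filterlim_compose[OF c])
  have "c \<le> 1/2"
    by (rule LIMSEQ_le[OF filterlim_compose[OF c' even] filterlim_compose[OF limit_even even]])
       (intro exI[of _ 0] allI impI disc_value_le_even[OF _ refl], simp)
  moreover have "5/9 \<le> c"
    by (rule LIMSEQ_le[OF filterlim_compose[OF limit_odd odd] filterlim_compose[OF c' odd]])
       (intro exI[of _ 0] allI impI disc_value_ge_odd[OF _ refl], simp)
  ultimately show False by simp
qed

end
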